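(* Let $\mathbb{F}_q$ be a finite field and $n\ge1$. The subalgebra of $\mathrm{End}(\mathscr{A}(n,\mathbb{F}_q))$ generated by all extension operators $\mathrm{L}^W,\mathrm{R}^W$, $W$ ranging over subspaces of $(\mathbb{F}_q)^n$, is commutative.
   Context: A partial isomorphism of $(\mathbb{F}_q)^n$ is a quadruple $(V,W,g_1,g_2)$ where $V,W$ are subspaces of the same dimension $k$ and $g_1:V\to W$, $g_2:W\to V$ are linear isomorphisms; $\mathscr{A}(n,\mathbb{F}_q)$ is the complex vector space with basis the set of partial isomorphisms. An extension is a partial isomorphism $(V^+,W^+,g_1^+,g_2^+)$ with $V\subset V^+$, $W\subset W^+$, $g_1^+|_V=g_1$, $g_2^+|_W=g_2$; it is trivial if there are decompositions $V^+=V\oplus A$, $W^+=W\oplus B$ and an isomorphism $\psi:A\to B$ with $g_1^+=g_1\oplus\psi$, $g_2^+=g_2\oplus\psi^{-1}$. Let $(x)_m=(1-x)\cdots(1-x^m)$, $(x)_0=1$, and $E_q(n,k^+,k,k_1)=q^{(n+k-k_1)(k^+-k)}(q^{-1})_{n-k}/(q^{-1})_{n-k^+}$. For $I=(U,V,g_1,g_2)$ of degree $k$, with $k_1$ the dimension of the fixed space of $g_2\circ g_1$, and $V^+\supset V$ (resp. $U^+\supset U$) of dimension $k^+$, $\mathrm{R}_V^{V^+}(I)$ (resp. $\mathrm{L}_U^{U^+}(I)$) is $\frac{1}{E_q(n,k^+,k,k_1)}$ times the sum of all trivial extensions of $I$ with right subspace $V^+$ (resp. left subspace $U^+$), the other subspace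 being arbitrary. The extension operators are the linear endomorphisms of $\mathscr{A}(n,\mathbb{F}_q)$ defined by $\mathrm{R}^W(U,V,g_1,g_2)=\mathrm{R}_V^{V+W}(U,V,g_1,g_2)$ and $\mathrm{L}^W(U,V,g_1,g_2)=\mathrm{L}_U^{U+W}(U,V,g_1,g_2)$. *)

theory Defs
  imports "HOL-Analysis.Analysis" "HOL-Library.FuncSet" "HOL-Library.Set_Algebras"
begin

text \<open>
  The space \<open>(\<bbbF>\<^sub>q)\<^sup>n\<close> is \<open>'a ^ 'n\<close> with \<open>'a\<close> a finite field, \<open>q = CARD('a)\<close> and \<open>n = CARD('n)\<close>.
  Sums of subspaces are the pointwise sums of sets from \<open>Set_Algebras\<close>.
\<close>

text \<open>
  The condition \<open>g \<in> extensional V\<close> gives each map \<open>V \<rightarrow> W\<close> exactly one representative.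
\<close>

definition linear_iso_on :: "('a::field ^ 'n) set \<Rightarrow> ('a ^ 'n) set \<Rightarrow> ('a ^ 'n \<Rightarrow> 'a ^ 'n) \<Rightarrow> bool"
  where "linear_iso_on V W g \<longleftrightarrow>
    g \<in> extensional V \<and> bij_betw g V W \<and>
    (\<forall>x\<in>V. \<forall>y\<in>V. g (x + y) = g x + g y) \<and>
    (\<forall>c. \<forall>x\<in>V. g (c *s x) = c *s g x)"

definition is_partial_iso ::
  "('a::field ^ 'n) set \<times> ('a ^ 'n) set \<times> ('a ^ 'n \<Rightarrow> 'a ^ 'n) \<times> ('a ^ 'n \<Rightarrow> 'a ^ 'n) \<Rightarrow> bool"
  where "is_partial_iso = (\<lambda>(V, W, g1, g2).
    vec.subspace V \<and> vec.subspace W \<and> vec.dim V = vec.dim W \<and>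
    linear_iso_on V W g1 \<and> linear_iso_on W V g2)"

typedef (overloaded) ('a, 'n) partial_iso =
  "{I :: ('a::{field,finite} ^ 'n::finite) set \<times> ('a ^ 'n) set \<times>
      ('a ^ 'n \<Rightarrow> 'a ^ 'n) \<times> ('a ^ 'n \<Rightarrow> 'a ^ 'n). is_partial_iso I}"
proof
  let ?g = "restrict (\<lambda>x. x) {0} :: 'a ^ 'n \<Rightarrow> 'a ^ 'n"
  show "({0}, {0}, ?g, ?g) \<in> {I. is_partial_iso I}"
    by (auto simp: is_partial_iso_def linear_iso_on_def bij_betw_def)
qed

instance partial_iso :: ("{field,finite}", finite) finite
proof
  have "inj (Rep_partial_iso :: ('a, 'b) partial_iso \<Rightarrow> _)"
    by (simp add: inj_def Rep_partial_iso_inject)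
  then show "finite (UNIV :: ('a, 'b) partial_iso set)"
    by (rule finite_imageD[rotated]) simp
qed

definition lspace :: "('a::{field,finite}, 'n::finite) partial_iso \<Rightarrow> ('a ^ 'n) set"
  where "lspace I = (case Rep_partial_iso I of (V, W, g1, g2) \<Rightarrow> V)"

definition rspace :: "('a::{field,finite}, 'n::finite) partial_iso \<Rightarrow> ('a ^ 'n) set"
  where "rspace I = (case Rep_partial_iso I of (V, W, g1, g2) \<Rightarrow> W)"

definition fwd :: "('a::{field,finite}, 'n::finite) partial_iso \<Rightarrow> 'a ^ 'n \<Rightarrow> 'a ^ 'n"
  where "fwd I = (case Rep_partial_iso I of (V, W, g1, g2) \<Rightarrow> g1)"

definition bwd :: "('a::{field,finite}, 'n::finite) partial_iso \<Rightarrow> 'a ^ 'n \<Rightarrow> 'a ^ 'n"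
  where "bwd I = (case Rep_partial_iso I of (V, W, g1, g2) \<Rightarrow> g2)"

definition pdeg :: "('a::{field,finite}, 'n::finite) partial_iso \<Rightarrow> nat"
  where "pdeg I = vec.dim (lspace I)"

definition fixed_dim :: "('a::{field,finite}, 'n::finite) partial_iso \<Rightarrow> nat"
  where "fixed_dim I = vec.dim {x \<in> lspace I. bwd I (fwd I x) = x}"

definition is_extension ::
  "('a::{field,finite}, 'n::finite) partial_iso \<Rightarrow> ('a, 'n) partial_iso \<Rightarrow> bool"
  where "is_extension I J \<longleftrightarrow>
    lspace I \<subseteq> lspace J \<and> rspace I \<subseteq> rspace J \<and>
    (\<forall>x\<in>lspace I. fwd J x = fwd I x) \<and> (\<forall>y\<in>rspace I. bwd J y = bwd I y)"

definition is_direct_sum :: "('a::field ^ 'n) set \<Rightarrow> ('a ^ 'n) set \<Rightarrow> ('a ^ 'n) set \<Rightarrow> bool"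
  where "is_direct_sum S V A \<longleftrightarrow>
    vec.subspace V \<and> vec.subspace A \<and> V \<inter> A = {0} \<and> S = V + A"

definition is_trivial_extension ::
  "('a::{field,finite}, 'n::finite) partial_iso \<Rightarrow> ('a, 'n) partial_iso \<Rightarrow> bool"
  where "is_trivial_extension I J \<longleftrightarrow> is_extension I J \<and>
    (\<exists>A B \<psi>. is_direct_sum (lspace J) (lspace I) A \<and> is_direct_sum (rspace J) (rspace I) B \<and>
      linear_iso_on A B \<psi> \<and>
      (\<forall>x\<in>lspace I. \<forall>a\<in>A. fwd J (x + a) = fwd I x + \<psi> a) \<and>
      (\<forall>y\<in>rspace I. \<forall>b\<in>B. bwd J (y + b) = bwd I y + inv_into A \<psi> b))"

definition qfact :: "complex \<Rightarrow> nat \<Rightarrow> complex"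
  where "qfact x m = (\<Prod>i=1..m. 1 - x ^ i)"

text \<open>
  Truncated subtraction is harmless here: the arguments always satisfy
  \<open>k1 \<le> k \<le> k' \<le> n\<close>, where \<open>k'\<close> stands for \<open>k\<^sup>+\<close>.
\<close>

definition Eq :: "nat \<Rightarrow> nat \<Rightarrow> nat \<Rightarrow> nat \<Rightarrow> nat \<Rightarrow> complex"
  where "Eq q n k' k k1 =
    of_nat q ^ ((n + k - k1) * (k' - k)) *
      qfact (inverse (of_nat q)) (n - k) / qfact (inverse (of_nat q)) (n - k')"

text \<open>
  The free complex vector space on the (finitely many) partial isomorphisms;
  the basis vector of \<open>I\<close> is \<open>axis I 1\<close>.
\<close>

type_synonym ('a, 'n) pi_space = "complex ^ ('a, 'n) partial_iso"

definition right_ext ::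
  "('a::{field,finite} ^ 'n::finite) set \<Rightarrow> ('a, 'n) partial_iso \<Rightarrow> ('a, 'n) pi_space"
  where "right_ext V' I =
    (1 / Eq CARD('a) CARD('n) (vec.dim V') (pdeg I) (fixed_dim I)) *s
      (\<Sum>J | is_trivial_extension I J \<and> rspace J = V'. axis J 1)"

definition left_ext ::
  "('a::{field,finite} ^ 'n::finite) set \<Rightarrow> ('a, 'n) partial_iso \<Rightarrow> ('a, 'n) pi_space"
  where "left_ext U' I =
    (1 / Eq CARD('a) CARD('n) (vec.dim U') (pdeg I) (fixed_dim I)) *s
      (\<Sum>J | is_trivial_extension I J \<and> lspace J = U'. axis J 1)"

definition R_op ::
  "('a::{field,finite} ^ 'n::finite) set \<Rightarrow> ('a, 'n) pi_space \<Rightarrow> ('a, 'n) pi_space"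
  where "R_op W v = (\<Sum>I\<in>UNIV. (v $ I) *s right_ext (rspace I + W) I)"

definition L_op ::
  "('a::{field,finite} ^ 'n::finite) set \<Rightarrow> ('a, 'n) pi_space \<Rightarrow> ('a, 'n) pi_space"
  where "L_op W v = (\<Sum>I\<in>UNIV. (v $ I) *s left_ext (lspace I + W) I)"

lemma linear_sum_scale:
  fixes f :: "'p::finite \<Rightarrow> 'b::field ^ 'm"
  shows "Vector_Spaces.linear (*s) (*s) (\<lambda>v :: 'b ^ 'p. \<Sum>I\<in>UNIV. (v $ I) *s f I)"
  by unfold_locales
    (simp_all add: vec.scale_left_distrib sum.distrib vec.scale_sum_right)

lemma linear_R_op: "Vector_Spaces.linear (*s) (*s) (R_op W)"
  unfolding R_op_def[abs_def] by (rule linear_sum_scale)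

lemma linear_L_op: "Vector_Spaces.linear (*s) (*s) (L_op W)"
  unfolding L_op_def[abs_def] by (rule linear_sum_scale)

lemma R_op_axis: "R_op W (axis I 1) = right_ext (rspace I + W) I"
proof -
  have "R_op W (axis I 1) = (\<Sum>K\<in>UNIV. if K = I then right_ext (rspace K + W) K else 0)"
    unfolding R_op_def by (rule sum.cong) (auto simp: axis_def)
  then show ?thesis by simp
qed

lemma L_op_axis: "L_op W (axis I 1) = left_ext (lspace I + W) I"
proof -
  have "L_op W (axis I 1) = (\<Sum>K\<in>UNIV. if K = I then left_ext (lspace K + W) K else 0)"
    unfolding L_op_def by (rule sum.cong) (auto simp: axis_def)
  then show ?thesis by simp
qed

definition is_subalgebra_End :: "(complex ^ 'p \<Rightarrow> complex ^ 'p) set \<Rightarrow> bool"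
  where "is_subalgebra_End X \<longleftrightarrow>
    (\<forall>S\<in>X. Vector_Spaces.linear (*s) (*s) S) \<and>
    id \<in> X \<and>
    (\<forall>S\<in>X. \<forall>T\<in>X. (\<lambda>v. S v + T v) \<in> X) \<and>
    (\<forall>c. \<forall>S\<in>X. (\<lambda>v. c *s S v) \<in> X) \<and>
    (\<forall>S\<in>X. \<forall>T\<in>X. S \<circ> T \<in> X)"

definition extension_operators ::
  "(('a::{field,finite}, 'n::finite) pi_space \<Rightarrow> ('a, 'n) pi_space) set"
  where "extension_operators = {L_op W | W. vec.subspace W} \<union> {R_op W | W. vec.subspace W}"

definition extension_algebra ::
  "(('a::{field,finite}, 'n::finite) pi_space \<Rightarrow> ('a, 'n) pi_space) set"
  where "extension_algebra = is_subalgebra_End hull extension_operators"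

end

theory Submission
  imports Defs
begin

text \<open>
  Write \<open>Fix J\<close> for the fixed space of \<open>g\<^sub>2 \<circ> g\<^sub>1\<close> in the left space of \<open>J\<close>.  An extension \<open>J\<close> of \<open>I\<close>
  is trivial iff the left space of \<open>J\<close> is the sum of that of \<open>I\<close> and \<open>Fix J\<close>.  Hence trivial
  extensions compose, and if \<open>K\<close> is a trivial extension of \<open>I\<close>, then \<open>g\<^sub>2 \<circ> g\<^sub>1\<close> is the identity modulo
  the left space of \<open>I\<close>, so every subspace between the left spaces of \<open>I\<close> and \<open>K\<close> is the left space
  of exactly one intermediate partial isomorphism \<open>J\<close>, and both steps \<open>I\<close> to \<open>J\<close> to \<open>K\<close> are trivial.
  The normalising constants are multiplicative along such chains.

  Below a fixed \<open>K\<close>, the operators L and R look alike: the condition on the right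
  spaces can be pulled back along the forward map of \<open>K\<close>, so an operator sends \<open>I\<close> to those \<open>J\<close> whose
  left space is the one of \<open>I\<close> plus a subspace \<open>X\<close> depending only on \<open>K\<close>.  Hence the coefficient of \<open>K\<close>
  in a product of two operators applied to \<open>I\<close> only depends on \<open>X\<^sub>1 + X\<^sub>2\<close>.
\<close>

section \<open>Subspaces\<close>

lemma set_plus_eq_sums: "S + T = {x + y |x y. x \<in> S \<and> y \<in> T}"
  by (auto simp: set_plus_def)

lemma subspace_set_plus:
  fixes S T :: "('a::field ^ 'n) set"
  assumes "vec.subspace S" "vec.subspace T"
  shows "vec.subspace (S + T)"
  unfolding set_plus_eq_sums by (rule vec.subspace_sums[OF assms])

lemma dim_set_plus_Int:
  fixes S T :: "('a::field ^ 'n) set"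
  assumes "vec.subspace S" "vec.subspace T"
  shows "vec.dim (S + T) + vec.dim (S \<inter> T) = vec.dim S + vec.dim T"
  unfolding set_plus_eq_sums by (rule vec.dim_sums_Int[OF assms])

lemma subset_set_plus1:
  fixes S T :: "('a::field ^ 'n) set"
  assumes "vec.subspace T"
  shows "S \<subseteq> S + T"
  using set_zero_plus2[of T S] vec.subspace_0[OF assms] by (simp add: add.commute)

lemma subset_set_plus2:
  fixes S T :: "('a::field ^ 'n) set"
  assumes "vec.subspace S"
  shows "T \<subseteq> S + T"
  using set_zero_plus2[of S T] vec.subspace_0[OF assms] by simp

lemma set_plus_subset_subspace:
  fixes S T U :: "('a::field ^ 'n) set"
  assumes "vec.subspace U" "S \<subseteq> U" "T \<subseteq> U"
  shows "S + T \<subseteq> U"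
  using assms by (auto elim!: set_plus_elim intro!: vec.subspace_add)

text \<open>The complement is the kernel, inside \<open>T\<close>, of a linear projection
  \<open>p\<close> onto \<open>S\<close>, through the splitting
  \<open>x = p x + (x - p x)\<close>.\<close>

lemma subspace_complement_exists:
  fixes S T :: "('a::field ^ 'n) set"
  assumes "vec.subspace S" "vec.subspace T" "S \<subseteq> T"
  obtains A where "vec.subspace A" "A \<subseteq> T" "S \<inter> A = {0}" "T = S + A"
proof -
  have "Vector_Spaces.linear (*s) (*s) (\<lambda>x :: 'a ^ 'n. x)"
    by unfold_locales auto
  \<comment> \<open>A left inverse of the identity map on \<open>S\<close> with range in
    \<open>S\<close> is such a projection.\<close>
  from vec.linear_exists_left_inverse_on[OF this assms(1)] obtain p :: "'a ^ 'n \<Rightarrow> 'a ^ 'n"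
    where p: "range p \<subseteq> S" "Vector_Spaces.linear (*s) (*s) p" "\<And>v. v \<in> S \<Longrightarrow> p v = v"
    by (auto simp: inj_on_def)
  interpret p: Vector_Spaces.linear "(*s)" "(*s)" p by (fact p(2))
  define A where "A = {x \<in> T. p x = 0}"
  have "vec.subspace A"
    using assms(2) by (auto simp: A_def vec.subspace_def p.add p.scale)
  moreover have "A \<subseteq> T"
    by (auto simp: A_def)
  moreover have "S \<inter> A = {0}"
    using p(3) assms vec.subspace_0 by (auto simp: A_def)
  moreover have "T = S + A"
  proof
    show "T \<subseteq> S + A"
    proof
      fix x assume x: "x \<in> T"
      have px: "p x \<in> S" using p(1) by auto
      then have "x - p x \<in> A"
        using x assms p(3) by (auto simp: A_def p.diff intro!: vec.subspace_diff)
      then have "p x + (x - p x) \<in> S + A" using px by blast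
      then show "x \<in> S + A" by simp
    qed
    show "S + A \<subseteq> T"
      using assms \<open>A \<subseteq> T\<close> by (intro set_plus_subset_subspace)
  qed
  ultimately show thesis by (rule that)
qed

text \<open>Linearity is assumed on \<open>S\<close> only, since the maps of a partial isomorphism
  are linear only on their domains. The image of \<open>S\<close> is spanned by the images of a
  basis of \<open>S\<close>.\<close>

lemma dim_image_le_on:
  fixes S :: "('a::field ^ 'n) set" and g :: "'a ^ 'n \<Rightarrow> 'a ^ 'n"
  assumes S: "vec.subspace S"
    and add: "\<And>x y. x \<in> S \<Longrightarrow> y \<in> S \<Longrightarrow> g (x + y) = g x + g y"
    and scale: "\<And>c x. x \<in> S \<Longrightarrow> g (c *s x) = c *s g x"
  shows "vec.dim (g ` S) \<le> vec.dim S"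
proof -
  obtain B where B: "B \<subseteq> S" "vec.independent B" "S \<subseteq> vec.span B" "card B = vec.dim S"
    using vec.basis_exists by metis
  have fin: "finite B" using B(2) by (rule vec.finiteI_independent)
  have g0: "g 0 = 0"
    using scale[of 0 0] vec.subspace_0[OF S] by simp
  have "vec.subspace {x \<in> S. g x \<in> vec.span (g ` B)}"
    using S g0 by (auto simp: vec.subspace_def add scale vec.span_zero vec.span_add vec.span_scale)
  moreover have "B \<subseteq> {x \<in> S. g x \<in> vec.span (g ` B)}"
    using B(1) by (auto intro: vec.span_base)
  ultimately have "vec.span B \<subseteq> {x \<in> S. g x \<in> vec.span (g ` B)}"
    by (rule vec.span_minimal[rotated])
  then have "g ` S \<subseteq> vec.span (g ` B)"
    using B(3) by auto
  then have "vec.dim (g ` S) \<le> card (g ` B)"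
    using fin by (intro vec.dim_le_card) auto
  also have "\<dots> \<le> card B" using fin by (rule card_image_le)
  finally show ?thesis using B(4) by simp
qed

section \<open>Partial isomorphisms\<close>

lemma Rep_partial_iso_eq: "Rep_partial_iso I = (lspace I, rspace I, fwd I, bwd I)"
  by (simp add: lspace_def rspace_def fwd_def bwd_def split: prod.split)

lemma is_partial_iso_components: "is_partial_iso (lspace I, rspace I, fwd I, bwd I)"
  using Rep_partial_iso[of I] by (simp add: Rep_partial_iso_eq)

lemma partial_iso_eqI:
  assumes "lspace I = lspace J" "rspace I = rspace J" "fwd I = fwd J" "bwd I = bwd J"
  shows "I = J"
  using assms by (metis Rep_partial_iso_eq Rep_partial_iso_inject)

lemma partial_iso_exists:
  fixes V W :: "('a::{field,finite} ^ 'n::finite) set"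
  assumes "is_partial_iso (V, W, g, h)"
  obtains J :: "('a, 'n) partial_iso"
  where "lspace J = V" "rspace J = W" "fwd J = g" "bwd J = h"
proof
  have *: "Rep_partial_iso (Abs_partial_iso (V, W, g, h)) = (V, W, g, h)"
    using assms by (simp add: Abs_partial_iso_inverse)
  show "lspace (Abs_partial_iso (V, W, g, h)) = V" "rspace (Abs_partial_iso (V, W, g, h)) = W"
    "fwd (Abs_partial_iso (V, W, g, h)) = g" "bwd (Abs_partial_iso (V, W, g, h)) = h"
    by (simp_all add: lspace_def rspace_def fwd_def bwd_def *)
qed

lemma subspace_lspace [simp]: "vec.subspace (lspace I)"
  and subspace_rspace [simp]: "vec.subspace (rspace I)"
  and dim_rspace: "vec.dim (rspace I) = pdeg I"
  and linear_iso_fwd: "linear_iso_on (lspace I) (rspace I) (fwd I)"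
  and linear_iso_bwd: "linear_iso_on (rspace I) (lspace I) (bwd I)"
  using is_partial_iso_components[of I] by (simp_all add: is_partial_iso_def pdeg_def)

lemma fwd_add: "x \<in> lspace I \<Longrightarrow> y \<in> lspace I \<Longrightarrow> fwd I (x + y) = fwd I x + fwd I y"
  and fwd_scale: "x \<in> lspace I \<Longrightarrow> fwd I (c *s x) = c *s fwd I x"
  and inj_on_fwd: "inj_on (fwd I) (lspace I)"
  and fwd_image: "fwd I ` lspace I = rspace I"
  and fwd_extensional: "fwd I \<in> extensional (lspace I)"
  using linear_iso_fwd[of I] by (auto simp: linear_iso_on_def bij_betw_def)

lemma bwd_add: "x \<in> rspace I \<Longrightarrow> y \<in> rspace I \<Longrightarrow> bwd I (x + y) = bwd I x + bwd I y"
  and bwd_scale: "x \<in> rspace I \<Longrightarrow> bwd I (c *s x) = c *s bwd I x"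
  and inj_on_bwd: "inj_on (bwd I) (rspace I)"
  and bwd_image: "bwd I ` rspace I = lspace I"
  and bwd_extensional: "bwd I \<in> extensional (rspace I)"
  using linear_iso_bwd[of I] by (auto simp: linear_iso_on_def bij_betw_def)

lemma fwd_in_rspace: "x \<in> lspace I \<Longrightarrow> fwd I x \<in> rspace I"
  using fwd_image[of I] by auto

lemma bwd_in_lspace: "y \<in> rspace I \<Longrightarrow> bwd I y \<in> lspace I"
  using bwd_image[of I] by auto

lemma zero_in_lspace: "0 \<in> lspace I"
  by (simp add: vec.subspace_0)

lemma zero_in_rspace: "0 \<in> rspace I"
  by (simp add: vec.subspace_0)

lemma fwd_zero: "fwd I 0 = 0"
  using fwd_scale[OF zero_in_lspace, of I 0] by simp

lemma bwd_zero: "bwd I 0 = 0"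
  using bwd_scale[OF zero_in_rspace, of I 0] by simp

lemma subspace_fwd_image:
  assumes "vec.subspace U" "U \<subseteq> lspace I"
  shows "vec.subspace (fwd I ` U)"
  unfolding vec.subspace_def
proof (intro conjI ballI allI)
  show "0 \<in> fwd I ` U"
    using vec.subspace_0[OF assms(1)] fwd_zero[of I] by (metis image_eqI)
  fix x y assume "x \<in> fwd I ` U" "y \<in> fwd I ` U"
  then show "x + y \<in> fwd I ` U"
    using assms vec.subspace_add[OF assms(1)] by (auto simp: fwd_add[symmetric] subset_iff)
next
  fix c x assume "x \<in> fwd I ` U"
  then show "c *s x \<in> fwd I ` U"
    using assms vec.subspace_scale[OF assms(1)] by (auto simp: fwd_scale[symmetric] subset_iff)
qed

lemma fwd_image_set_plus:
  assumes "S \<subseteq> lspace I" "T \<subseteq> lspace I"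
  shows "fwd I ` (S + T) = fwd I ` S + fwd I ` T"
proof -
  have "fwd I (x + y) = fwd I x + fwd I y" if "x \<in> S" "y \<in> T" for x y
    using that assms by (auto intro: fwd_add)
  then show ?thesis by (force simp: set_plus_def image_iff)
qed

section \<open>The fixed space of the composite of the two maps\<close>

definition fixed_space :: "('a::{field,finite}, 'n::finite) partial_iso \<Rightarrow> ('a ^ 'n) set"
  where "fixed_space I = {x \<in> lspace I. bwd I (fwd I x) = x}"

lemma fixed_dim_eq: "fixed_dim I = vec.dim (fixed_space I)"
  by (simp add: fixed_dim_def fixed_space_def)

lemma fixed_space_subset: "fixed_space I \<subseteq> lspace I"
  by (auto simp: fixed_space_def)

lemma subspace_fixed_space [simp]: "vec.subspace (fixed_space I)"
  unfolding vec.subspace_def fixed_space_def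
  by (auto simp: fwd_zero bwd_zero fwd_add fwd_scale bwd_add bwd_scale fwd_in_rspace
      zero_in_lspace vec.subspace_add vec.subspace_scale)

section \<open>Trivial extensions\<close>

lemma is_extension_trans: "is_extension I J \<Longrightarrow> is_extension J K \<Longrightarrow> is_extension I K"
  by (auto simp: is_extension_def subset_iff)

lemma fixed_space_extension:
  assumes "is_extension I J"
  shows "fixed_space I = fixed_space J \<inter> lspace I"
  using assms fwd_in_rspace[of _ I] by (auto simp: fixed_space_def is_extension_def)

lemma rspace_extension:
  assumes "is_extension J K"
  shows "rspace J = fwd K ` lspace J"
  using assms fwd_image[of J] by (auto simp: is_extension_def image_iff)

text \<open>Both maps of anything below \<open>K\<close> are restrictions of those of
  \<open>K\<close>, and its right space is the \<open>fwd K\<close>-image of its left space.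
  Extensionality turns agreement on the domains into equality.\<close>

lemma extension_eqI:
  assumes "is_extension J K" "is_extension J' K" "lspace J = lspace J'"
  shows "J = J'"
proof (rule partial_iso_eqI)
  show r: "rspace J = rspace J'"
    using assms rspace_extension by metis
  show "fwd J = fwd J'"
    using assms fwd_extensional[of J] fwd_extensional[of J']
    by (intro extensionalityI[of _ "lspace J"]) (auto simp: is_extension_def)
  show "bwd J = bwd J'"
    using assms r bwd_extensional[of J] bwd_extensional[of J']
    by (intro extensionalityI[of _ "rspace J"]) (auto simp: is_extension_def)
qed (fact assms)

text \<open>This trades the choice of \<open>A\<close>, \<open>B\<close> and \<open>\<psi>\<close>
  for the canonical subspace \<open>fixed_space J\<close>. A complement \<open>A\<close> that
  witnesses triviality is fixed pointwise; conversely, a complement can be chosen inside the fixed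
  space, with \<open>B\<close> its image under \<open>fwd J\<close>.\<close>

lemma is_trivial_extension_iff:
  "is_trivial_extension I J \<longleftrightarrow> is_extension I J \<and> lspace J = lspace I + fixed_space J"
proof (intro iffI conjI)
  assume triv: "is_trivial_extension I J"
  then show "is_extension I J" by (simp add: is_trivial_extension_def)
  then have IJ: "lspace I \<subseteq> lspace J" by (simp add: is_extension_def)
  from triv obtain A B \<psi> where A: "is_direct_sum (lspace J) (lspace I) A"
    and B: "is_direct_sum (rspace J) (rspace I) B" and \<psi>: "linear_iso_on A B \<psi>"
    and f: "\<And>x a. x \<in> lspace I \<Longrightarrow> a \<in> A \<Longrightarrow> fwd J (x + a) = fwd I x + \<psi> a"
    and b: "\<And>y b. y \<in> rspace I \<Longrightarrow> b \<in> B \<Longrightarrow> bwd J (y + b) = bwd I y + inv_into A \<psi> b"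
    by (auto simp: is_trivial_extension_def)
  have AJ: "lspace J = lspace I + A" "A \<subseteq> lspace J"
    using A subset_set_plus2[of "lspace I" A] by (auto simp: is_direct_sum_def)
  have "a \<in> fixed_space J" if a: "a \<in> A" for a
  proof -
    have "\<psi> a \<in> B" "inv_into A \<psi> (\<psi> a) = a"
      using \<psi> a by (auto simp: linear_iso_on_def bij_betw_def)
    then have "bwd J (fwd J a) = a"
      using f[OF zero_in_lspace a] b[OF zero_in_rspace, of "\<psi> a"] by (simp add: fwd_zero bwd_zero)
    then show ?thesis using a AJ by (auto simp: fixed_space_def)
  qed
  then have "lspace J \<subseteq> lspace I + fixed_space J"
    unfolding AJ(1) by (intro set_plus_mono2) auto
  moreover have "lspace I + fixed_space J \<subseteq> lspace J"
    using IJ fixed_space_subset by (intro set_plus_subset_subspace) auto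
  ultimately show "lspace J = lspace I + fixed_space J" by blast
next
  assume asm: "is_extension I J \<and> lspace J = lspace I + fixed_space J"
  then have ext: "is_extension I J" and sum: "lspace J = lspace I + fixed_space J" by auto
  have sub: "lspace I \<subseteq> lspace J" "rspace I \<subseteq> rspace J"
    and fI: "\<And>x. x \<in> lspace I \<Longrightarrow> fwd J x = fwd I x"
    and bI: "\<And>x. x \<in> rspace I \<Longrightarrow> bwd J x = bwd I x"
    using ext by (auto simp: is_extension_def)
  \<comment> \<open>The fixed space may meet \<open>lspace I\<close>. Splitting off this
    intersection makes the sum with \<open>lspace I\<close> direct.\<close>
  obtain A where A: "vec.subspace A" "A \<subseteq> fixed_space J"
    "(lspace I \<inter> fixed_space J) \<inter> A = {0}" "fixed_space J = (lspace I \<inter> fixed_space J) + A"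
    using subspace_complement_exists[of "lspace I \<inter> fixed_space J" "fixed_space J"]
    by (metis inf_le2 subspace_fixed_space subspace_lspace vec.subspace_inter)
  have AJ: "A \<subseteq> lspace J" using A(2) fixed_space_subset by blast
  have fix_A: "bwd J (fwd J a) = a" if "a \<in> A" for a
    using that A(2) by (auto simp: fixed_space_def)
  have int: "lspace I \<inter> A = {0}" using A(2,3) by blast
  have "lspace I + (lspace I \<inter> fixed_space J) = lspace I"
    by (intro antisym set_plus_subset_subspace subset_set_plus1)
      (auto intro: vec.subspace_inter)
  then have dl: "lspace J = lspace I + A"
    using sum A(4) add.assoc[of "lspace I" "lspace I \<inter> fixed_space J" A] by simp
  define B where "B = fwd J ` A"
  define \<psi> where "\<psi> = restrict (fwd J) A"
  have "rspace I = fwd J ` lspace I" using rspace_extension[OF ext] .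
  then have dr: "rspace J = rspace I + B"
    using fwd_image_set_plus[OF sub(1) AJ] dl fwd_image[of J] by (simp add: B_def)
  have inj_A: "inj_on (fwd J) A" using inj_on_fwd AJ by (rule inj_on_subset)
  have intr: "rspace I \<inter> B = {0}"
  proof -
    have "rspace I \<inter> B = fwd J ` (lspace I \<inter> A)"
      unfolding B_def \<open>rspace I = fwd J ` lspace I\<close>
      using inj_on_image_Int[OF inj_on_fwd sub(1) AJ] by simp
    then show ?thesis by (simp add: int fwd_zero)
  qed
  have "linear_iso_on A B \<psi>"
    using inj_A A(1) AJ unfolding linear_iso_on_def \<psi>_def B_def
    by (auto simp: bij_betw_def subset_iff fwd_add fwd_scale vec.subspace_add vec.subspace_scale)
  moreover have "fwd J (x + a) = fwd I x + \<psi> a" if "x \<in> lspace I" "a \<in> A" for x a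
    using that sub AJ fI by (auto simp: \<psi>_def fwd_add subset_iff)
  moreover have "bwd J (y + b) = bwd I y + inv_into A \<psi> b" if y: "y \<in> rspace I" and b: "b \<in> B" for y b
  proof -
    from b obtain a where a: "a \<in> A" "b = fwd J a" by (auto simp: B_def)
    have "inj_on \<psi> A" "b = \<psi> a" using inj_A a by (auto simp: \<psi>_def)
    then have "inv_into A \<psi> b = a" using a by simp
    moreover have "b \<in> rspace J" using a AJ fwd_in_rspace by blast
    ultimately show ?thesis
      using y sub bI[OF y] a fix_A[OF a(1)] by (auto simp: bwd_add subset_iff)
  qed
  moreover have "is_direct_sum (lspace J) (lspace I) A"
    using A(1) int dl by (simp add: is_direct_sum_def)
  moreover have "is_direct_sum (rspace J) (rspace I) B"
    using subspace_fwd_image[OF A(1) AJ] intr dr by (simp add: is_direct_sum_def B_def)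
  ultimately show "is_trivial_extension I J"
    unfolding is_trivial_extension_def using ext by blast
qed

lemma trivial_extension_imp_extension: "is_trivial_extension I J \<Longrightarrow> is_extension I J"
  by (simp add: is_trivial_extension_def)

text \<open>The fixed space of \<open>J\<close> lies in that of \<open>K\<close>, so adding both to
  \<open>lspace I\<close> is the same as adding the larger one.\<close>

lemma trivial_extension_trans:
  assumes "is_trivial_extension I J" "is_trivial_extension J K"
  shows "is_trivial_extension I K"
proof -
  have JK: "is_extension J K" and "is_extension I K"
    using assms is_extension_trans by (auto simp: is_trivial_extension_iff)
  have "fixed_space J + fixed_space K = fixed_space K"
    using fixed_space_extension[OF JK] subspace_fixed_space[of J]
    by (intro antisym set_plus_subset_subspace subset_set_plus2) auto
  then have "lspace K = lspace I + fixed_space K"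
    using assms unfolding is_trivial_extension_iff by (simp add: add.assoc)
  with \<open>is_extension I K\<close> show ?thesis by (simp add: is_trivial_extension_iff)
qed

text \<open>From \<open>J\<close> to \<open>K\<close> this is monotonicity of sums. From
  \<open>I\<close> to \<open>J\<close> it is a modular law: if \<open>x = u + f\<close> lies in
  \<open>lspace J\<close> with \<open>u\<close> in \<open>lspace I\<close>, then the fixed vector
  \<open>f\<close> lies in \<open>lspace J\<close> too.\<close>

lemma trivial_extension_between:
  assumes "is_extension I J" "is_extension J K" "is_trivial_extension I K"
  shows "is_trivial_extension I J" "is_trivial_extension J K"
proof -
  have IJ: "lspace I \<subseteq> lspace J" and JK: "lspace J \<subseteq> lspace K"
    using assms by (auto simp: is_extension_def)
  have K: "lspace K = lspace I + fixed_space K"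
    using assms by (simp add: is_trivial_extension_iff)
  have "lspace K \<subseteq> lspace J + fixed_space K"
    unfolding K using IJ by (intro set_plus_mono2) auto
  moreover have "lspace J + fixed_space K \<subseteq> lspace K"
    using JK fixed_space_subset by (intro set_plus_subset_subspace) auto
  ultimately show "is_trivial_extension J K"
    using assms by (auto simp: is_trivial_extension_iff)
  have "lspace J \<subseteq> lspace I + fixed_space J"
  proof
    fix x assume x: "x \<in> lspace J"
    then obtain u f where uf: "x = u + f" "u \<in> lspace I" "f \<in> fixed_space K"
      using JK K by (metis set_plus_elim subsetD)
    have "f = x - u" using uf by simp
    then have "f \<in> lspace J"
      using x uf(2) IJ vec.subspace_diff[OF subspace_lspace, of x J u] by auto
    then have "f \<in> fixed_space J" using uf fixed_space_extension[OF assms(2)] by blast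
    then show "x \<in> lspace I + fixed_space J" using uf by blast
  qed
  moreover have "lspace I + fixed_space J \<subseteq> lspace J"
    using IJ fixed_space_subset by (intro set_plus_subset_subspace) auto
  ultimately show "is_trivial_extension I J"
    using assms by (auto simp: is_trivial_extension_iff)
qed

text \<open>\<open>J\<close> is the restriction of \<open>K\<close> to \<open>U\<close> and its
  image \<open>W\<close>. What needs proof is that \<open>bwd K\<close> maps \<open>W\<close> back
  onto \<open>U\<close>: the composite of the two maps preserves \<open>lspace I\<close> and fixes
  the remaining summand of each vector of \<open>U\<close>.\<close>

lemma trivial_extension_intermediate_exists:
  fixes I K :: "('a::{field,finite}, 'n::finite) partial_iso"
  assumes triv: "is_trivial_extension I K"
    and U: "vec.subspace U" "lspace I \<subseteq> U" "U \<subseteq> lspace K"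
  obtains J where "is_trivial_extension I J" "is_trivial_extension J K" "lspace J = U"
proof -
  have ext: "is_extension I K" and sum: "lspace K = lspace I + fixed_space K"
    using triv by (auto simp: is_trivial_extension_iff)
  have IK: "lspace I \<subseteq> lspace K" "\<And>x. x \<in> lspace I \<Longrightarrow> fwd K x = fwd I x"
    "\<And>y. y \<in> rspace I \<Longrightarrow> bwd K y = bwd I y"
    using ext by (auto simp: is_extension_def)
  define W where "W = fwd K ` U"
  have W: "vec.subspace W" "W \<subseteq> rspace K"
    using subspace_fwd_image[OF U(1,3)] U(3) fwd_in_rspace by (auto simp: W_def)
  have "bwd K (fwd K x) \<in> U" if x: "x \<in> U" for x
  proof -
    from x U(3) sum obtain u f where uf: "x = u + f" "u \<in> lspace I" "f \<in> fixed_space K"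
      by (metis set_plus_elim subsetD)
    have fK: "f \<in> lspace K" "bwd K (fwd K f) = f" using uf by (auto simp: fixed_space_def)
    have uK: "u \<in> lspace K" using uf IK by blast
    have "bwd K (fwd K u) \<in> U"
      using uf IK U(2) fwd_in_rspace[of u I] bwd_in_lspace[of "fwd I u" I] by auto
    moreover have "f \<in> U"
      using x uf U by (metis add_diff_cancel_left' subsetD vec.subspace_diff)
    moreover have "bwd K (fwd K x) = bwd K (fwd K u) + f"
      using fK uK by (simp add: uf(1) fwd_add bwd_add fwd_in_rspace)
    ultimately show ?thesis using U(1) by (simp add: vec.subspace_add)
  qed
  then have "bwd K ` W \<subseteq> U" by (auto simp: W_def)
  moreover have inj: "inj_on (fwd K) U" "inj_on (bwd K) W"
    using inj_on_subset[OF inj_on_fwd U(3)] inj_on_subset[OF inj_on_bwd W(2)] by auto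
  \<comment> \<open>Over a finite field, injectivity and counting upgrade the inclusion in
    \<open>U\<close> to equality.\<close>
  then have "card (bwd K ` W) = card U"
    by (simp add: W_def card_image)
  ultimately have bW: "bwd K ` W = U" by (intro card_subset_eq) auto
  have "vec.dim W \<le> vec.dim U"
    unfolding W_def using U by (intro dim_image_le_on) (auto simp: fwd_add fwd_scale subset_iff)
  moreover have "vec.dim U \<le> vec.dim W"
    unfolding bW[symmetric] using W
    by (intro dim_image_le_on) (auto simp: bwd_add bwd_scale subset_iff)
  ultimately have dim: "vec.dim U = vec.dim W" by simp
  have "linear_iso_on U W (restrict (fwd K) U)"
    using U inj unfolding linear_iso_on_def
    by (auto simp: bij_betw_def W_def subset_iff fwd_add fwd_scale vec.subspace_add vec.subspace_scale)
  moreover have "linear_iso_on W U (restrict (bwd K) W)"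
    using W inj bW unfolding linear_iso_on_def
    by (auto simp: bij_betw_def subset_iff bwd_add bwd_scale vec.subspace_add vec.subspace_scale)
  ultimately have "is_partial_iso (U, W, restrict (fwd K) U, restrict (bwd K) W)"
    using U W dim by (simp add: is_partial_iso_def)
  then obtain J :: "('a, 'n) partial_iso" where J: "lspace J = U" "rspace J = W"
    "fwd J = restrict (fwd K) U" "bwd J = restrict (bwd K) W"
    by (rule partial_iso_exists)
  have "rspace I \<subseteq> W"
    using rspace_extension[OF ext] U(2) by (auto simp: W_def)
  then have "is_extension I J" "is_extension J K"
    using J U W IK by (auto simp: is_extension_def subset_iff)
  with trivial_extension_between[OF this triv] J(1) show thesis by (intro that)
qed

section \<open>Coefficients\<close>

lemma pdeg_mono:
  assumes "is_extension I J"
  shows "pdeg I \<le> pdeg J"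
  using assms unfolding pdeg_def is_extension_def by (intro vec.dim_subset) auto

lemma pdeg_le: "pdeg (I :: ('a::{field,finite}, 'n::finite) partial_iso) \<le> CARD('n)"
  using vec.dim_subset[of "lspace I" UNIV] unfolding pdeg_def vec_dim_card by blast

lemma fixed_dim_le: "fixed_dim I \<le> pdeg I"
  unfolding pdeg_def fixed_dim_eq by (intro vec.dim_subset fixed_space_subset)

text \<open>The dimension formula for \<open>lspace I + fixed_space J\<close>, whose intersection
  term is \<open>fixed_space I\<close>. Thus degree minus fixed dimension is invariant under trivial
  extension.\<close>

lemma fixed_dim_trivial_extension:
  assumes "is_trivial_extension I J"
  shows "pdeg J + fixed_dim I = pdeg I + fixed_dim J"
proof -
  have "fixed_space I = lspace I \<inter> fixed_space J" "lspace J = lspace I + fixed_space J"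
    using assms fixed_space_extension[of I J] by (auto simp: is_trivial_extension_iff)
  then show ?thesis
    using dim_set_plus_Int[of "lspace I" "fixed_space J"] by (simp add: pdeg_def fixed_dim_eq)
qed

lemma qfact_nonzero:
  assumes "1 < q"
  shows "qfact (inverse (of_nat q)) m \<noteq> 0"
proof -
  have "inverse (of_nat q) ^ i \<noteq> (1 :: complex)" if "1 \<le> i" for i
  proof
    assume "inverse (of_nat q) ^ i = (1 :: complex)"
    then have "(of_nat q :: complex) ^ i = 1" by (simp add: power_inverse)
    then have "q ^ i = 1" by (metis of_nat_1 of_nat_eq_iff of_nat_power)
    then show False using assms that by simp
  qed
  then show ?thesis by (auto simp: qfact_def)
qed

text \<open>The last hypothesis says \<open>k - k1 = k' - k1'\<close>, so both powers of
  \<open>q\<close> have the same factor \<open>n + k - k1\<close> in the exponent and the exponents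
  add up. The \<open>qfact\<close> quotients telescope; the cancelled factor is nonzero by
  \<open>qfact_nonzero\<close>.\<close>

lemma Eq_mult:
  assumes "1 < q" "k \<le> k'" "k' \<le> k''" "k'' \<le> n" "k1 \<le> k" "k' + k1 = k + k1'"
  shows "Eq q n k' k k1 * Eq q n k'' k' k1' = Eq q n k'' k k1"
proof -
  have "n + k' - k1' = n + k - k1" using assms by linarith
  moreover have "(n + k - k1) * (k' - k) + (n + k - k1) * (k'' - k') = (n + k - k1) * (k'' - k)"
    using assms by (simp add: distrib_left[symmetric])
  ultimately show ?thesis
    using qfact_nonzero[OF assms(1), of "n - k'"]
    by (simp add: Eq_def power_add[symmetric] field_simps)
qed

lemma card_field_gt_1: "1 < CARD('a::{field,finite})"
proof -
  have "card {0, 1 :: 'a} \<le> CARD('a)" by (intro card_mono) auto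
  then show ?thesis by simp
qed

text \<open>One coefficient serves left and right operators alike, because both spaces of
  \<open>K\<close> have dimension \<open>pdeg K\<close>.\<close>

definition ext_coeff :: "('a::{field,finite}, 'n::finite) partial_iso \<Rightarrow> ('a, 'n) partial_iso \<Rightarrow> complex"
  where "ext_coeff I K = 1 / Eq CARD('a) CARD('n) (pdeg K) (pdeg I) (fixed_dim I)"

lemma ext_coeff_mult:
  assumes "is_trivial_extension I J" "is_trivial_extension J K"
  shows "ext_coeff I J * ext_coeff J K = ext_coeff I K"
proof -
  have "is_extension I J" "is_extension J K"
    using assms by (auto intro: trivial_extension_imp_extension)
  then have "Eq CARD('a) CARD('b) (pdeg J) (pdeg I) (fixed_dim I) *
      Eq CARD('a) CARD('b) (pdeg K) (pdeg J) (fixed_dim J) =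
      Eq CARD('a) CARD('b) (pdeg K) (pdeg I) (fixed_dim I)"
    using assms by (intro Eq_mult card_field_gt_1 pdeg_mono pdeg_le fixed_dim_le
        fixed_dim_trivial_extension)
  then show ?thesis by (simp add: ext_coeff_def)
qed

section \<open>Operators summing over selected trivial extensions\<close>

text \<open>A matrix coefficient of an operator in the basis of partial isomorphisms, with source
  \<open>I\<close> and target \<open>K\<close>; \<open>Q\<close> selects the admissible
  targets.\<close>

definition ext_entry ::
  "(('a::{field,finite}, 'n::finite) partial_iso \<Rightarrow> ('a, 'n) partial_iso \<Rightarrow> bool) \<Rightarrow>
    ('a, 'n) partial_iso \<Rightarrow> ('a, 'n) partial_iso \<Rightarrow> complex"
  where "ext_entry Q I K = (if is_trivial_extension I K \<and> Q I K then ext_coeff I K else 0)"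

definition ext_op ::
  "(('a::{field,finite}, 'n::finite) partial_iso \<Rightarrow> ('a, 'n) partial_iso \<Rightarrow> bool) \<Rightarrow>
    ('a, 'n) pi_space \<Rightarrow> ('a, 'n) pi_space"
  where "ext_op Q v = (\<Sum>I\<in>UNIV. (v $ I) *s (\<chi> K. ext_entry Q I K))"

lemma ext_op_nth: "ext_op Q v $ K = (\<Sum>I\<in>UNIV. v $ I * ext_entry Q I K)"
  by (simp add: ext_op_def)

section \<open>The operators L and R in matrix form\<close>

lemma sum_axis_nth:
  "(\<Sum>J\<in>A. axis J (1::complex)) $ K = (if K \<in> A then 1 else 0)" for K :: "'p::finite"
  by (simp add: axis_def if_distrib eq_commute[of K] cong: if_cong)

lemma right_ext_eq:
  "right_ext V I = (\<chi> K. ext_entry (\<lambda>I K. rspace K = V) I K)"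
  by (auto simp: vec_eq_iff right_ext_def sum_axis_nth ext_entry_def ext_coeff_def dim_rspace
      simp del: sum_component)

lemma left_ext_eq:
  "left_ext V I = (\<chi> K. ext_entry (\<lambda>I K. lspace K = V) I K)"
  by (auto simp: vec_eq_iff left_ext_def sum_axis_nth ext_entry_def ext_coeff_def pdeg_def
      simp del: sum_component)

lemma R_op_eq: "R_op W = ext_op (\<lambda>I K. rspace K = rspace I + W)"
  by (simp add: fun_eq_iff R_op_def ext_op_def right_ext_eq ext_entry_def)

lemma L_op_eq: "L_op W = ext_op (\<lambda>I K. lspace K = lspace I + W)"
  by (simp add: fun_eq_iff L_op_def ext_op_def left_ext_eq ext_entry_def)

text \<open>The flag \<open>C\<close> is there for right operators: if \<open>W\<close> is not
  contained in \<open>rspace K\<close>, no \<open>J\<close> below \<open>K\<close> can be selected,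
  whatever \<open>X\<close> is.\<close>

definition adds_subspace_below ::
  "('a::{field,finite}, 'n::finite) partial_iso \<Rightarrow> bool \<Rightarrow> ('a ^ 'n) set \<Rightarrow>
    (('a, 'n) partial_iso \<Rightarrow> ('a, 'n) partial_iso \<Rightarrow> bool) \<Rightarrow> bool"
  where "adds_subspace_below K C X Q \<longleftrightarrow> vec.subspace X \<and>
    (\<forall>I J. is_extension I J \<longrightarrow> is_extension J K \<longrightarrow> Q I J = (C \<and> lspace J = lspace I + X))"

definition adds_subspace ::
  "(('a::{field,finite}, 'n::finite) partial_iso \<Rightarrow> ('a, 'n) partial_iso \<Rightarrow> bool) \<Rightarrow> bool"
  where "adds_subspace Q \<longleftrightarrow> (\<forall>K. \<exists>C X. adds_subspace_below K C X Q)"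

lemma adds_subspace_left:
  assumes "vec.subspace W"
  shows "adds_subspace (\<lambda>I K. lspace K = lspace I + W)"
proof -
  have "adds_subspace_below K True W (\<lambda>I K. lspace K = lspace I + W)" for K
    using assms by (simp add: adds_subspace_below_def)
  then show ?thesis unfolding adds_subspace_def by blast
qed

text \<open>Here \<open>X\<close> is the preimage of \<open>W\<close> under \<open>fwd K\<close>,
  and \<open>C\<close> states that \<open>W\<close> lies in \<open>rspace K\<close>, so that
  \<open>fwd K\<close> maps \<open>X\<close> onto \<open>W\<close>. Injectivity of
  \<open>fwd K\<close> transfers the equation of right spaces to left spaces.\<close>

lemma adds_subspace_right:
  assumes W: "vec.subspace W"
  shows "adds_subspace (\<lambda>I K. rspace K = rspace I + W)"
  unfolding adds_subspace_def
proof
  fix K :: "('a, 'b) partial_iso"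
  define X where "X = {x \<in> lspace K. fwd K x \<in> W}"
  have X: "vec.subspace X" "X \<subseteq> lspace K"
    using W unfolding X_def vec.subspace_def
    by (auto simp: fwd_zero fwd_add fwd_scale zero_in_lspace vec.subspace_add vec.subspace_scale)
  have "rspace J = rspace I + W \<longleftrightarrow> W \<subseteq> rspace K \<and> lspace J = lspace I + X"
    if ext: "is_extension I J" "is_extension J K" for I J
  proof -
    have sub: "lspace I \<subseteq> lspace K" "lspace J \<subseteq> lspace K" "rspace J \<subseteq> rspace K"
      using ext is_extension_trans[OF ext] by (auto simp: is_extension_def)
    have r: "rspace I = fwd K ` lspace I" "rspace J = fwd K ` lspace J"
      using ext is_extension_trans[OF ext] rspace_extension by blast+
    have sum: "lspace I + X \<subseteq> lspace K"
      using sub X by (intro set_plus_subset_subspace) auto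
    have "W \<subseteq> rspace J" if "rspace J = rspace I + W"
      unfolding that by (rule subset_set_plus2) simp
    then have "rspace J = rspace I + W \<longleftrightarrow> W \<subseteq> rspace K \<and> rspace J = rspace I + W"
      using sub by blast
    also have "\<dots> \<longleftrightarrow> W \<subseteq> rspace K \<and> rspace J = rspace I + fwd K ` X"
    proof -
      have "fwd K ` X = W" if "W \<subseteq> rspace K"
        using that unfolding X_def fwd_image[of K, symmetric] by auto
      then show ?thesis by auto
    qed
    also have "\<dots> \<longleftrightarrow> W \<subseteq> rspace K \<and> fwd K ` lspace J = fwd K ` (lspace I + X)"
      using fwd_image_set_plus[OF sub(1) X(2)] r by simp
    also have "\<dots> \<longleftrightarrow> W \<subseteq> rspace K \<and> lspace J = lspace I + X"
      using inj_on_image_eq_iff[OF inj_on_fwd sub(2) sum] by simp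
    finally show ?thesis .
  qed
  then have "adds_subspace_below K (W \<subseteq> rspace K) X (\<lambda>I K. rspace K = rspace I + W)"
    using X(1) by (simp add: adds_subspace_below_def)
  then show "\<exists>C X. adds_subspace_below K C X (\<lambda>I K. rspace K = rspace I + W)" by blast
qed

text \<open>At most one \<open>J\<close> contributes: the one between \<open>I\<close> and
  \<open>K\<close> with left space \<open>lspace I + X1\<close>. Its contribution is
  \<open>ext_coeff I K\<close> by \<open>ext_coeff_mult\<close>, so no trace of \<open>J\<close>
  remains.\<close>

lemma sum_ext_entry:
  assumes 1: "adds_subspace_below K C1 X1 Q1" and 2: "adds_subspace_below K C2 X2 Q2"
  shows "(\<Sum>J\<in>UNIV. ext_entry Q1 I J * ext_entry Q2 J K) =
    (if is_trivial_extension I K \<and> C1 \<and> C2 \<and> lspace K = lspace I + (X1 + X2)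
      then ext_coeff I K else 0)"
proof -
  have X1: "vec.subspace X1" and X2: "vec.subspace X2"
    using 1 2 by (simp_all add: adds_subspace_below_def)
  define P where "P J \<longleftrightarrow> is_trivial_extension I J \<and> is_trivial_extension J K \<and> Q1 I J \<and> Q2 J K" for J
  \<comment> \<open>The second factor has target \<open>K\<close> itself, so its selection condition
    is applied to the pair \<open>J\<close>, \<open>K\<close> below \<open>K\<close>.\<close>
  have KK: "is_extension K K" by (simp add: is_extension_def)
  have P_iff: "P J \<longleftrightarrow> is_trivial_extension I J \<and> is_trivial_extension J K \<and> C1 \<and> C2 \<and>
      lspace J = lspace I + X1 \<and> lspace K = lspace J + X2" for J
    using 1 2 KK trivial_extension_imp_extension[of I J] trivial_extension_imp_extension[of J K]
    unfolding P_def adds_subspace_below_def by blast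
  have entry: "ext_entry Q1 I J * ext_entry Q2 J K = (if P J then ext_coeff I K else 0)" for J
    using ext_coeff_mult by (auto simp: ext_entry_def P_def)
  show ?thesis
  proof (cases "is_trivial_extension I K \<and> C1 \<and> C2 \<and> lspace K = lspace I + (X1 + X2)")
    case True
    have "vec.subspace (lspace I + X1)" "lspace I \<subseteq> lspace I + X1"
      using X1 by (simp_all add: subspace_set_plus subset_set_plus1)
    moreover have "lspace I + X1 \<subseteq> lspace K"
      using True subset_set_plus1[OF X2, of "lspace I + X1"] by (simp add: add.assoc)
    ultimately obtain J0 where J0: "is_trivial_extension I J0" "is_trivial_extension J0 K"
      "lspace J0 = lspace I + X1"
      using True trivial_extension_intermediate_exists by metis
    have "P J \<longleftrightarrow> J = J0" for J
    proof
      assume "P J"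
      then show "J = J0"
        using J0 by (intro extension_eqI[of J K]) (auto simp: P_iff trivial_extension_imp_extension)
    qed (use J0 True in \<open>auto simp: P_iff add.assoc\<close>)
    then show ?thesis using True by (simp add: entry)
  next
    case False
    have "\<not> P J" for J
    proof
      assume "P J"
      then have "is_trivial_extension I K" "C1" "C2" "lspace K = lspace I + (X1 + X2)"
        by (auto simp: P_iff add.assoc intro: trivial_extension_trans)
      then show False using False by simp
    qed
    then show ?thesis unfolding if_not_P[OF False] by (simp add: entry)
  qed
qed

text \<open>For each \<open>K\<close>, the formula of \<open>sum_ext_entry\<close> is symmetric in
  the pairs \<open>C1\<close>, \<open>X1\<close> and \<open>C2\<close>, \<open>X2\<close>, so the
  two composites have equal matrix entries.\<close>

lemma ext_op_commute:
  assumes "adds_subspace Q1" "adds_subspace Q2"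
  shows "ext_op Q1 \<circ> ext_op Q2 = ext_op Q2 \<circ> ext_op Q1"
proof -
  have entry: "(\<Sum>J\<in>UNIV. ext_entry Q1 I J * ext_entry Q2 J K) =
      (\<Sum>J\<in>UNIV. ext_entry Q2 I J * ext_entry Q1 J K)" for I K
  proof -
    obtain C1 X1 C2 X2
      where *: "adds_subspace_below K C1 X1 Q1" "adds_subspace_below K C2 X2 Q2"
      using assms unfolding adds_subspace_def by meson
    show ?thesis
      unfolding sum_ext_entry[OF *] sum_ext_entry[OF *(2,1)] by (auto simp: add.commute)
  qed
  \<comment> \<open>The operator applied first supplies the entry from \<open>I\<close> to the
    intermediate \<open>J\<close>.\<close>
  have comp: "ext_op Q' (ext_op Q v) $ K =
      (\<Sum>I\<in>UNIV. v $ I * (\<Sum>J\<in>UNIV. ext_entry Q I J * ext_entry Q' J K))" for Q Q' v K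
    unfolding ext_op_nth sum_distrib_left sum_distrib_right
    by (subst sum.swap) (simp add: mult.assoc)
  show ?thesis
    by (simp add: fun_eq_iff vec_eq_iff comp entry)
qed

section \<open>Generated subalgebras\<close>

text \<open>Commuting with \<open>S\<close> passes to sums and scalar multiples only through
  linearity of \<open>S\<close>. Restricting to linear \<open>S\<close> makes the claim hold for an
  arbitrary set \<open>X\<close>.\<close>

lemma is_subalgebra_End_commutant:
  "is_subalgebra_End {T. Vector_Spaces.linear (*s) (*s) T \<and>
    (\<forall>S\<in>X. Vector_Spaces.linear (*s) (*s) S \<longrightarrow> S \<circ> T = T \<circ> S)}"
  unfolding is_subalgebra_End_def
  by (auto simp: fun_eq_iff vec.linear_id Vector_Spaces.linear_compose vec.linear_compose_add
      vec.linear_compose_scale_right vec.linear_add vec.linear_scale)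

text \<open>A double commutant argument: the commutant of \<open>X\<close> is a subalgebra
  containing \<open>X\<close>, hence contains the hull. So \<open>X\<close> lies in the commutant of
  the hull, which is again a subalgebra and therefore contains the hull.\<close>

lemma hull_is_subalgebra_End_commute:
  assumes lin: "\<And>S. S \<in> X \<Longrightarrow> Vector_Spaces.linear (*s) (*s) S"
    and comm: "\<And>S T. S \<in> X \<Longrightarrow> T \<in> X \<Longrightarrow> S \<circ> T = T \<circ> S"
    and S: "S \<in> is_subalgebra_End hull X" and T: "T \<in> is_subalgebra_End hull X"
  shows "S \<circ> T = T \<circ> S"
proof -
  let ?C = "\<lambda>X. {T. Vector_Spaces.linear (*s) (*s) T \<and>
    (\<forall>S\<in>X. Vector_Spaces.linear (*s) (*s) S \<longrightarrow> S \<circ> T = T \<circ> S)}"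
  have sub: "is_subalgebra_End hull X \<subseteq> ?C X"
    using lin comm by (intro hull_minimal is_subalgebra_End_commutant) auto
  then have "X \<subseteq> ?C (is_subalgebra_End hull X)"
    using lin by fastforce
  then have "is_subalgebra_End hull X \<subseteq> ?C (is_subalgebra_End hull X)"
    by (intro hull_minimal is_subalgebra_End_commutant)
  then show ?thesis using S T by auto
qed

theorem theorem2p11:
  fixes S T :: "('a::{field,finite}, 'n::finite) pi_space \<Rightarrow> ('a, 'n) pi_space"
  assumes "S \<in> extension_algebra" and "T \<in> extension_algebra"
  shows "S \<circ> T = T \<circ> S"
proof (rule hull_is_subalgebra_End_commute)
  show "S \<in> is_subalgebra_End hull extension_operators"
    "T \<in> is_subalgebra_End hull extension_operators"
    using assms by (simp_all add: extension_algebra_def)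
next
  fix S :: "('a, 'n) pi_space \<Rightarrow> ('a, 'n) pi_space"
  assume "S \<in> extension_operators"
  then show "Vector_Spaces.linear (*s) (*s) S"
    by (auto simp: extension_operators_def linear_L_op linear_R_op)
next
  fix S T :: "('a, 'n) pi_space \<Rightarrow> ('a, 'n) pi_space"
  \<comment> \<open>Every generator, left or right, takes the common form to which
    \<open>ext_op_commute\<close> applies.\<close>
  have op: "\<exists>Q. adds_subspace Q \<and> S = ext_op Q" if "S \<in> extension_operators"
    for S :: "('a, 'n) pi_space \<Rightarrow> ('a, 'n) pi_space"
    using that adds_subspace_left adds_subspace_right
    by (fastforce simp: extension_operators_def L_op_eq R_op_eq)
  assume "S \<in> extension_operators" "T \<in> extension_operators"
  then show "S \<circ> T = T \<circ> S"
    using op[of S] op[of T] ext_op_commute by blast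
qed

end
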